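(* For every width-$w$ DNF formula $f$ and every $\varepsilon>0$, there exist DNF formulae $f_\ell,f_u$, each of width $w$ and size at most $(w\log(1/\varepsilon))^{O(w)}$, which are $\varepsilon$-sandwiching approximators for $f$.
   Context: A term is a conjunction (AND) of literals; a DNF formula on $n$ variables is an OR of terms and computes a function $\{0,1\}^n\to\{0,1\}$. Its size is its number of terms and its width is the maximum number of literals in a term; a formula is called a width-$w$ formula if each of its terms has at most $w$ literals. The formula $f$ may have an arbitrary number of terms and variables. The constant implied by $O(w)$ is absolute. Functions $f_\ell,f_u:\{0,1\}^n\to\{0,1\}$ are $\varepsilon$-sandwiching approximators for $f:\{0,1\}^n\to\{0,1\}$ if $f_\ell(x)\le f(x)\le f_u(x)$ for every $x\in\{0,1\}^n$, and $\Pr_x[f_\ell(x)\ne f(x)]\le\varepsilon$ and $\Pr_x[f_u(x)\ne f(x)]\le\varepsilon$, where $x$ is uniform in $\{0,1\}^n$.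
   Formalization: The size bound reads w log(1/ε) as max(2, w log₂(1/min(ε,1/2))): ε above 1/2 is replaced by 1/2 in the bound only, and the base is at least 2, since the literal bound fails, e.g. for w=1, 1/2<ε<1, f=x₁. *)

theory Defs
  imports "HOL-Probability.Probability"
begin

datatype lit = Pos nat | Neg nat

fun lit_var :: "lit \<Rightarrow> nat" where
  "lit_var (Pos i) = i"
| "lit_var (Neg i) = i"

fun lit_eval :: "lit \<Rightarrow> (nat \<Rightarrow> bool) \<Rightarrow> bool" where
  "lit_eval (Pos i) x = x i"
| "lit_eval (Neg i) x = (\<not> x i)"

text \<open>
  A term is the set of its literals (the empty term is the constant 1; a term may contain a
  variable together with its negation), and a DNF formula is the set of its terms (the empty
  formula is the constant 0), so the size of a formula \<open>F\<close> is \<open>card F\<close>.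
\<close>

type_synonym dnf = "lit set set"

definition is_dnf :: "nat \<Rightarrow> dnf \<Rightarrow> bool" where
  "is_dnf n F \<longleftrightarrow> finite F \<and> (\<forall>T\<in>F. finite T \<and> (\<forall>l\<in>T. lit_var l < n))"

definition width_dnf :: "nat \<Rightarrow> nat \<Rightarrow> dnf \<Rightarrow> bool" where
  "width_dnf n w F \<longleftrightarrow> is_dnf n F \<and> (\<forall>T\<in>F. card T \<le> w)"

definition dnf_eval :: "dnf \<Rightarrow> (nat \<Rightarrow> bool) \<Rightarrow> bool" where
  "dnf_eval F x \<longleftrightarrow> (\<exists>T\<in>F. \<forall>l\<in>T. lit_eval l x)"

text \<open>
  The cube \<open>{0,1}\<^sup>n\<close>, as the functions on \<open>{..<n}\<close>; the dimension is a number rather than a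
  type so that constants can be chosen independently of it.
\<close>

definition cube :: "nat \<Rightarrow> (nat \<Rightarrow> bool) set" where
  "cube n = {..<n} \<rightarrow>\<^sub>E UNIV"

definition sandwiching ::
  "nat \<Rightarrow> real \<Rightarrow> ((nat \<Rightarrow> bool) \<Rightarrow> bool) \<Rightarrow> ((nat \<Rightarrow> bool) \<Rightarrow> bool) \<Rightarrow> ((nat \<Rightarrow> bool) \<Rightarrow> bool) \<Rightarrow> bool"
where
  "sandwiching n \<epsilon> fl fu f \<longleftrightarrow>
     (\<forall>x\<in>cube n. fl x \<le> f x \<and> f x \<le> fu x) \<and>
     measure_pmf.prob (pmf_of_set (cube n)) {x. fl x \<noteq> f x} \<le> \<epsilon> \<and>
     measure_pmf.prob (pmf_of_set (cube n)) {x. fu x \<noteq> f x} \<le> \<epsilon>"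

text \<open>
  The base \<open>w log(1/\<epsilon>)\<close> of the size bound. As usual in such asymptotic bounds, \<open>log(1/\<epsilon>)\<close> is
  bounded away from 0, by reading \<open>\<epsilon>\<close> as \<open>1/2\<close> if it is larger, and the base is at least 2.
  Otherwise no constant in the exponent would do: for \<open>w = 1\<close>, \<open>1/2 < \<epsilon> < 1\<close> and a
  non-zero \<open>f\<close>, the bound would be below 1 although \<open>f\<^sub>u\<close> needs a term, and for \<open>w = 1\<close> and
  \<open>\<epsilon>\<close> just below \<open>1/2\<close> it would allow only one term. If \<open>\<epsilon> \<le> 1/2\<close> and
  \<open>w log(1/\<epsilon>) \<ge> 2\<close>, this is exactly \<open>w log(1/\<epsilon>)\<close>.
\<close>

definition size_base :: "nat \<Rightarrow> real \<Rightarrow> real" where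
  "size_base w \<epsilon> = max 2 (real w * log 2 (1 / min \<epsilon> (1/2)))"

end

theory Submission imports Defs begin

text \<open>
  Call a consistent term \<open>Y\<close> coverable if few terms of \<open>F\<close> already cover all but a tiny fraction
  of the points satisfying \<open>Y\<close>, where both the number of terms and the error allowed grow as
  \<open>Y\<close> gets shorter. The terms of \<open>F\<close> are coverable. If there were more than \<open>C\<^sup>k\<close> inclusion-minimal
  coverable terms of size \<open>k\<close>, then some of them would share a core \<open>Z\<close> such that the petals form
  a spread family. A random point satisfies some petal of a spread family with overwhelming
  probability, so \<open>Z\<close> would be coverable too, contradicting minimality. Hence the minimal coverable
  terms form a small upper approximator, and the union of their covers is a small lower one;
  the two differ with tiny probability.

  The petals contain negated literals, so the monotone inequality of Janson does not apply to
  them. Instead the variables are coloured at random with \<open>t\<close> colours. By the second moment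
  method, in each colour some monochromatic petal is satisfied with probability at least \<open>1/2\<close>,
  and distinct colours are independent, whence a failure probability of at most \<open>2\<^sup>-\<^sup>t\<close>.
\<close>

section \<open>Counting in finite function spaces and the second moment method\<close>

lemma card_PiE_fixed:
  assumes "finite I" "J \<subseteq> I" "\<And>j. j \<in> J \<Longrightarrow> g j \<in> B"
  shows "card {f \<in> I \<rightarrow>\<^sub>E B. \<forall>j\<in>J. f j = g j} = card B ^ (card I - card J)"
proof -
  have "{f \<in> I \<rightarrow>\<^sub>E B. \<forall>j\<in>J. f j = g j} = Pi\<^sub>E I (\<lambda>i. if i \<in> J then {g i} else B)"
  proof (intro set_eqI iffI)
    fix f assume f: "f \<in> Pi\<^sub>E I (\<lambda>i. if i \<in> J then {g i} else B)"
    have "f i \<in> B" if "i \<in> I" for i using PiE_mem[OF f that] assms(3)[of i] by (cases "i \<in> J") auto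
    moreover have "f j = g j" if "j \<in> J" for j using PiE_mem[OF f, of j] assms(2) that by auto
    ultimately show "f \<in> {f \<in> I \<rightarrow>\<^sub>E B. \<forall>j\<in>J. f j = g j}"
      using f by (auto simp: PiE_iff)
  qed (auto simp: PiE_iff)
  also have "card \<dots> = (\<Prod>i\<in>I. if i \<in> J then 1 else card B)"
    using assms(1) by (auto simp: card_PiE intro!: prod.cong)
  also have "\<dots> = (\<Prod>i\<in>I - J. card B)"
    using assms(1) by (intro prod.mono_neutral_cong_right) auto
  also have "\<dots> = card B ^ (card I - card J)"
    using assms(1,2) by (simp add: card_Diff_subset finite_subset)
  finally show ?thesis .
qed

text \<open>Chebyshev's inequality in terms of counts. For the number of events \<open>A T\<close>
  that hold at a random point of \<open>\<Omega>\<close>, \<open>pairs\<close> bounds the variance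
  by \<open>\<eta>\<close> times the squared mean, and a point outside all events deviates from the
  mean by the mean itself.\<close>

lemma second_moment:
  fixes A :: "'b \<Rightarrow> 'a set" and \<eta> :: real
  assumes "finite \<Omega>" and sub: "\<And>T. T \<in> H \<Longrightarrow> A T \<subseteq> \<Omega>"
    and pos: "(\<Sum>T\<in>H. card (A T)) > 0"
    and pairs: "card \<Omega> * (\<Sum>T\<in>H. \<Sum>T'\<in>H. card (A T \<inter> A T')) \<le> (1 + \<eta>) * (\<Sum>T\<in>H. card (A T))\<^sup>2"
  shows "card {\<omega>\<in>\<Omega>. \<forall>T\<in>H. \<omega> \<notin> A T} \<le> \<eta> * card \<Omega>"
proof -
  define X where "X \<omega> = (\<Sum>T\<in>H. indicat_real (A T) \<omega>)" for \<omega>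
  define a where "a = real (\<Sum>T\<in>H. card (A T))"
  define N where "N = real (card \<Omega>)"
  have ind: "(\<Sum>\<omega>\<in>\<Omega>. indicat_real B \<omega>) = card B" if "B \<subseteq> \<Omega>" for B
    using assms(1) that by (simp add: indicator_def sum.If_cases Int_absorb1)
  have s1: "(\<Sum>\<omega>\<in>\<Omega>. X \<omega>) = a"
    unfolding X_def a_def by (subst sum.swap) (simp add: ind sub)
  have "(\<Sum>\<omega>\<in>\<Omega>. (X \<omega>)\<^sup>2) = (\<Sum>\<omega>\<in>\<Omega>. \<Sum>T\<in>H. \<Sum>T'\<in>H. indicat_real (A T \<inter> A T') \<omega>)"
    unfolding X_def power2_eq_square sum_product by (simp add: indicator_inter_arith)
  also have "\<dots> = (\<Sum>T\<in>H. \<Sum>T'\<in>H. \<Sum>\<omega>\<in>\<Omega>. indicat_real (A T \<inter> A T') \<omega>)"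
    by (subst sum.swap) (intro sum.cong refl, rule sum.swap)
  also have "\<dots> = real (\<Sum>T\<in>H. \<Sum>T'\<in>H. card (A T \<inter> A T'))"
    by (simp add: ind sub le_infI1)
  finally have s2: "N * (\<Sum>\<omega>\<in>\<Omega>. (X \<omega>)\<^sup>2) \<le> (1 + \<eta>) * a\<^sup>2"
    using pairs unfolding N_def a_def by simp
  let ?Z = "{\<omega>\<in>\<Omega>. \<forall>T\<in>H. \<omega> \<notin> A T}"
  have a: "a > 0" using pos unfolding a_def by linarith
  \<comment> \<open>The mean of \<open>X\<close> is \<open>a / N\<close>. Scaling the deviation by
    \<open>N\<close> avoids division, and it equals \<open>-a\<close> wherever \<open>X\<close>
    vanishes.\<close>
  have "card ?Z * a\<^sup>2 = (\<Sum>\<omega>\<in>?Z. (N * X \<omega> - a)\<^sup>2)"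
    by (simp add: X_def)
  also have "\<dots> \<le> (\<Sum>\<omega>\<in>\<Omega>. (N * X \<omega> - a)\<^sup>2)"
    using assms(1) by (intro sum_mono2) auto
  also have "\<dots> = N\<^sup>2 * (\<Sum>\<omega>\<in>\<Omega>. (X \<omega>)\<^sup>2) - 2 * N * a * (\<Sum>\<omega>\<in>\<Omega>. X \<omega>) + N * a\<^sup>2"
    by (simp add: power2_diff power_mult_distrib sum.distrib sum_subtractf N_def mult_ac
        flip: sum_distrib_left sum_distrib_right)
  also have "\<dots> \<le> N * ((1 + \<eta>) * a\<^sup>2) - N * a\<^sup>2"
    using mult_left_mono[OF s2, of N] unfolding s1 by (simp add: N_def power2_eq_square algebra_simps)
  also have "\<dots> = (\<eta> * N) * a\<^sup>2" by (simp add: algebra_simps)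
  finally show ?thesis using a unfolding N_def by simp
qed

text \<open>Swapping the restrictions to \<open>V\<close> of two points is an involution that matches the two sides.\<close>

lemma card_PiE_indep:
  fixes B :: "'b set"
  assumes P: "\<And>x y. (\<And>i. i \<in> V \<Longrightarrow> x i = y i) \<Longrightarrow> P x = P y"
    and Q: "\<And>x y. (\<And>i. i \<notin> V \<Longrightarrow> x i = y i) \<Longrightarrow> Q x = Q y"
  shows "card {x \<in> I \<rightarrow>\<^sub>E B. P x \<and> Q x} * card (I \<rightarrow>\<^sub>E B)
       = card {x \<in> I \<rightarrow>\<^sub>E B. P x} * card {x \<in> I \<rightarrow>\<^sub>E B. Q x}"
proof -
  define h :: "('a \<Rightarrow> 'b) \<times> ('a \<Rightarrow> 'b) \<Rightarrow> _" where
    "h = (\<lambda>(x, y). (\<lambda>i. if i \<in> V then x i else y i, \<lambda>i. if i \<in> V then y i else x i))"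
  have hh: "h (h z) = z" for z by (cases z) (auto simp: h_def)
  have P': "P (fst (h (x, y))) = P x" "Q (fst (h (x,y))) = Q y" "P (snd (h (x, y))) = P y" "Q (snd (h (x,y))) = Q x"
    for x y unfolding h_def fst_conv snd_conv split by (intro P Q; simp)+
  have m: "fst (h (x, y)) \<in> I \<rightarrow>\<^sub>E B" "snd (h (x, y)) \<in> I \<rightarrow>\<^sub>E B"
    if "x \<in> I \<rightarrow>\<^sub>E B" "y \<in> I \<rightarrow>\<^sub>E B" for x y
    using that by (auto simp: h_def PiE_iff extensional_def)
  have "bij_betw h ({x \<in> I \<rightarrow>\<^sub>E B. P x \<and> Q x} \<times> (I \<rightarrow>\<^sub>E B))
      ({x \<in> I \<rightarrow>\<^sub>E B. P x} \<times> {x \<in> I \<rightarrow>\<^sub>E B. Q x})"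
    by (rule bij_betw_byWitness[where f' = h])
      (auto simp: image_subset_iff hh mem_Times_iff m P' simp del: PiE_iff del: PiE_I)
  from bij_betw_same_card[OF this] show ?thesis by (simp add: card_cartesian_product)
qed

section \<open>Spread families of sets\<close>

lemma sum_Pow_power:
  fixes p :: "'a :: comm_semiring_1"
  assumes "finite U"
  shows "(\<Sum>S\<in>Pow U. p ^ card S) = (1 + p) ^ card U"
  using prod_add[OF assms, of "\<lambda>_. p" "\<lambda>_. 1"] by (simp add: add.commute)

text \<open>Each power of \<open>1 + p\<close> expands into a sum over the common subsets
  \<open>S\<close> of \<open>T\<close> and \<open>T'\<close>. After swapping the sums, spreadness
  bounds the number of \<open>T'\<close> above each \<open>S\<close>, and the binomial theorem
  collects the terms again. The sum measures the correlation of \<open>T\<close> with the family in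
  the second moment.\<close>

lemma spread_sum_le:
  fixes p :: real
  assumes "finite H" "\<And>T. T \<in> H \<Longrightarrow> finite T \<and> card T = k" "p \<ge> 0" "C > 0"
    and spread: "\<And>T S. T \<in> H \<Longrightarrow> S \<subseteq> T \<Longrightarrow> card {T'\<in>H. S \<subseteq> T'} \<le> C ^ (k - card S)"
    and T: "T \<in> H"
  shows "(\<Sum>T'\<in>H. (1 + p) ^ card (T \<inter> T')) \<le> real C ^ k * (1 + p / C) ^ k"
proof -
  have fT: "finite T" "card T = k" using assms(2) T by auto
  have "(\<Sum>T'\<in>H. (1 + p) ^ card (T \<inter> T')) = (\<Sum>T'\<in>H. \<Sum>S\<in>Pow (T \<inter> T'). p ^ card S)"
    using fT(1) by (simp add: sum_Pow_power del: Pow_Int_eq)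
  also have "\<dots> = (\<Sum>T'\<in>H. \<Sum>S | S \<in> Pow T \<and> S \<subseteq> T'. p ^ card S)"
    by (intro sum.cong refl) auto
  also have "\<dots> = (\<Sum>S\<in>Pow T. \<Sum>T' | T' \<in> H \<and> S \<subseteq> T'. p ^ card S)"
    using fT assms(1) by (intro sum.swap_restrict) auto
  also have "\<dots> = (\<Sum>S\<in>Pow T. real (card {T'\<in>H. S \<subseteq> T'}) * p ^ card S)"
    by simp
  also have "\<dots> \<le> (\<Sum>S\<in>Pow T. real C ^ k * (p / C) ^ card S)"
  proof (rule sum_mono)
    fix S assume S: "S \<in> Pow T"
    have le: "card S \<le> k" using S fT by (auto intro: card_mono)
    have "real (card {T'\<in>H. S \<subseteq> T'}) \<le> real C ^ (k - card S)"
      using spread[OF T, of S] S by (metis PowD of_nat_le_iff of_nat_power)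
    also have "\<dots> = real C ^ k / real C ^ card S"
      using assms(4) le by (simp add: power_diff)
    finally have "real (card {T'\<in>H. S \<subseteq> T'}) * p ^ card S \<le> real C ^ k / real C ^ card S * p ^ card S"
      using assms(3) by (intro mult_right_mono) auto
    then show "real (card {T'\<in>H. S \<subseteq> T'}) * p ^ card S \<le> real C ^ k * (p / C) ^ card S"
      by (simp add: power_divide)
  qed
  also have "\<dots> = real C ^ k * (1 + p / C) ^ k"
    using fT by (simp add: sum_Pow_power flip: sum_distrib_left)
  finally show ?thesis .
qed

text \<open>\<open>Z\<close> is a set of maximal size whose link in \<open>G\<close> is too large.\<close>

lemma spread_subfamily:
  fixes G :: "'a set set"
  assumes "finite G" "\<And>T. T \<in> G \<Longrightarrow> finite T \<and> card T = k" "card G > C ^ k"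
  obtains Z H where "H \<subseteq> G" "card Z < k" "finite Z" "\<And>T. T \<in> H \<Longrightarrow> Z \<subseteq> T"
    "card H = C ^ (k - card Z)"
    "\<And>S T. T \<in> H \<Longrightarrow> Z \<subseteq> S \<Longrightarrow> S \<subseteq> T \<Longrightarrow> card {T\<in>H. S \<subseteq> T} \<le> C ^ (k - card S)"
proof -
  let ?L = "\<lambda>Z. {T\<in>G. Z \<subseteq> T}"
  let ?Q = "\<lambda>Z. card (?L Z) > C ^ (k - card Z)"
  have bound: "finite Z \<and> card Z \<le> k" if Q: "?Q Z" for Z
  proof -
    have "?L Z \<noteq> {}" using Q by force
    then obtain T where "T \<in> G" "Z \<subseteq> T" by blast
    then show ?thesis using assms(2)[of T] by (auto intro: card_mono finite_subset)
  qed
  have "?Q {}" using assms(3) by simp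
  moreover have "\<forall>Z. ?Q Z \<longrightarrow> card Z < Suc k"
    by (intro allI impI le_imp_less_Suc conjunct2[OF bound])
  ultimately have "\<exists>Z. ?Q Z \<and> (\<forall>Y. ?Q Y \<longrightarrow> card Y \<le> card Z)"
    by (rule ex_has_greatest_nat[where P = ?Q and f = card])
  then obtain Z where Z: "?Q Z" and max: "\<And>Y. ?Q Y \<Longrightarrow> card Y \<le> card Z"
    by blast
  \<comment> \<open>A set of size \<open>k\<close> lies in at most one member of \<open>G\<close>,
    namely itself, so its link cannot exceed \<open>C ^ 0 = 1\<close>.\<close>
  have "card Z \<noteq> k"
  proof
    assume k: "card Z = k"
    have "T = Z" if "T \<in> G" "Z \<subseteq> T" for T
      using assms(2)[OF that(1)] that(2) k by (metis card_subset_eq)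
    then have "?L Z \<subseteq> {Z}" by blast
    then have "card (?L Z) \<le> 1" using card_mono[of "{Z}" "?L Z"] by simp
    then show False using Z k by simp
  qed
  with bound[OF Z] have Zk: "card Z < k" "finite Z" by auto
  \<comment> \<open>Trimming the link to exactly the threshold makes the bound hold for
    \<open>S = Z\<close> too; for larger \<open>S\<close> it follows from the maximality of
    \<open>Z\<close>.\<close>
  obtain H where H: "H \<subseteq> ?L Z" "card H = C ^ (k - card Z)"
    by (rule obtain_subset_with_card_n[OF less_imp_le[OF Z]])
  show thesis
  proof (rule that[of H Z])
    fix S T assume S: "T \<in> H" "Z \<subseteq> S" "S \<subseteq> T"
    have "finite T" using S(1) H(1) assms(2) by blast
    then have fin: "finite S" "finite (?L S)" "finite H"
      using S(3) H(1) assms(1) by (auto intro: finite_subset)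
    show "card {T\<in>H. S \<subseteq> T} \<le> C ^ (k - card S)"
    proof (cases "S = Z")
      case True
      then show ?thesis using H fin card_mono[of H "{T\<in>H. S \<subseteq> T}"] by auto
    next
      case False
      then have "card Z < card S" using S fin by (intro psubset_card_mono) auto
      then have "\<not> ?Q S" using max[of S] by linarith
      moreover have "card {T\<in>H. S \<subseteq> T} \<le> card (?L S)"
        using H fin by (intro card_mono) auto
      ultimately show ?thesis by linarith
    qed
  qed (use H Zk in auto)
qed

section \<open>Terms on the cube, and the failure probability of a spread family\<close>

abbreviation sat :: "lit set \<Rightarrow> (nat \<Rightarrow> bool) \<Rightarrow> bool" where
  "sat T x \<equiv> \<forall>l\<in>T. lit_eval l x"

lemma finite_cube: "finite (cube n)" and card_cube: "card (cube n) = 2 ^ n"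
  by (simp_all add: cube_def finite_PiE card_PiE)

text \<open>Consistency of a term is expressed as injectivity of \<open>lit_var\<close>. A
  consistent term prescribes one value for each of its variables, which reduces counting its points
  to counting functions with prescribed values.\<close>

lemma sat_iff:
  assumes "inj_on lit_var T"
  shows "sat T x \<longleftrightarrow> (\<forall>j\<in>lit_var ` T. x j = (Pos j \<in> T))"
proof -
  have "lit_eval l x \<longleftrightarrow> x (lit_var l) = (Pos (lit_var l) \<in> T)" if "l \<in> T" for l
  proof (cases l)
    case (Neg i)
    then have "Pos i \<notin> T" using inj_onD[OF assms, of "Pos i" l] that by auto
    then show ?thesis using Neg by simp
  qed (use that in simp)
  then show ?thesis by simp
qed

lemma card_sat:
  assumes "inj_on lit_var T" "lit_var ` T \<subseteq> {..<n}"
  shows "card {x \<in> cube n. sat T x} = 2 ^ (n - card T)"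
  using card_PiE_fixed[of "{..<n}" "lit_var ` T" "\<lambda>j. Pos j \<in> T" "UNIV :: bool set"] assms
  by (simp add: cube_def sat_iff card_image)

lemma unsat_if_inconsistent:
  assumes "\<not> inj_on lit_var T"
  shows "\<not> sat T x"
proof -
  obtain l m where lm: "l \<in> T" "m \<in> T" "lit_var l = lit_var m" "l \<noteq> m"
    using assms by (auto simp: inj_on_def)
  then have "lit_eval l x \<noteq> lit_eval m x" by (cases l; cases m) auto
  with lm show ?thesis by blast
qed

lemma card_colourings:
  assumes "inj_on lit_var T" "lit_var ` T \<subseteq> {..<n}" "i < t"
  shows "card {c \<in> {..<n} \<rightarrow>\<^sub>E {..<t}. \<forall>l\<in>T. c (lit_var l) = i} = t ^ (n - card T)"
  using card_PiE_fixed[of "{..<n}" "lit_var ` T" "\<lambda>_. i" "{..<t}"] assms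
  by (simp add: card_image)

text \<open>Events that read disjoint colour classes of variables are independent, so their
  probabilities of at most 1/2 multiply.\<close>

lemma card_blocks_le:
  fixes E :: "nat \<Rightarrow> (nat \<Rightarrow> bool) \<Rightarrow> bool"
  assumes dep: "\<And>i x y. (\<And>v. c v = i \<Longrightarrow> x v = y v) \<Longrightarrow> E i x = E i y"
    and half: "\<And>i. i < t \<Longrightarrow> card {x \<in> cube n. E i x} * 2 \<le> 2 ^ n"
  shows "card {x \<in> cube n. \<forall>i<t. E i x} * 2 ^ t \<le> 2 ^ n"
  using half
proof (induction t)
  case 0
  show ?case by (simp add: card_cube)
next
  case (Suc t)
  let ?N = "\<lambda>P. card {x \<in> cube n. P x}"
  have "?N (\<lambda>x. (\<forall>i<t. E i x) \<and> E t x) * card (cube n) = ?N (\<lambda>x. \<forall>i<t. E i x) * ?N (E t)"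
    unfolding cube_def
  \<comment> \<open>The first \<open>t\<close> events read only variables of colour below
    \<open>t\<close>, the event \<open>E t\<close> only variables outside that set.\<close>
  proof (rule card_PiE_indep[where V = "{v. c v < t}"])
    show "(\<forall>i<t. E i x) = (\<forall>i<t. E i y)" if "\<And>i. i \<in> {v. c v < t} \<Longrightarrow> x i = y i" for x y
      using that by (intro all_cong1 imp_cong refl dep) auto
    show "E t x = E t y" if "\<And>i. i \<notin> {v. c v < t} \<Longrightarrow> x i = y i" for x y
      using that by (intro dep) auto
  qed
  moreover have "{x \<in> cube n. \<forall>i<Suc t. E i x} = {x \<in> cube n. (\<forall>i<t. E i x) \<and> E t x}"
    by (auto simp: less_Suc_eq)
  ultimately have "?N (\<lambda>x. \<forall>i<Suc t. E i x) * 2 ^ n = ?N (\<lambda>x. \<forall>i<t. E i x) * ?N (E t)"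
    by (simp only: card_cube)
  then have "?N (\<lambda>x. \<forall>i<Suc t. E i x) * 2 ^ Suc t * 2 ^ n
      = (?N (\<lambda>x. \<forall>i<t. E i x) * 2 ^ t) * (?N (E t) * 2)"
    by (simp add: ac_simps)
  also have "\<dots> \<le> 2 ^ n * 2 ^ n"
    using Suc by (intro mult_le_mono) auto
  finally show ?case by simp
qed

text \<open>The constant 8 makes the increment at most \<open>1 / (4 * t * k)\<close>, so the power
  is at most the exponential of \<open>1 / (4 * t)\<close>. The result is the variance bound for the
  correlation sum with \<open>1 + p = 2 * t\<close>.\<close>

lemma power_one_plus_le:
  fixes k t C :: nat
  assumes "t \<ge> 1" "C \<ge> 8 * k * t\<^sup>2" "C > 0"
  shows "(1 + (2 * t - 1) / C) ^ k \<le> 1 + 1 / (2 * real t)"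
proof (cases "k = 0")
  case False
  let ?y = "1 / (4 * real t)"
  have "8 * real k * (real t)\<^sup>2 \<le> C"
    using assms(2) by (metis of_nat_le_iff of_nat_mult of_nat_numeral of_nat_power)
  then have "(2 * t - 1) / real C \<le> 2 * t / (8 * real k * (real t)\<^sup>2)"
    using assms False by (intro frac_le) auto
  also have "\<dots> = ?y / k"
    using assms False by (simp add: field_simps power2_eq_square)
  also have "1 + ?y / k \<le> exp (?y / k)" by simp
  finally have "(1 + (2 * t - 1) / C) ^ k \<le> exp (?y / k) ^ k"
    using assms by (intro power_mono) auto
  also have "\<dots> = exp ?y" using False by (simp flip: exp_of_nat_mult)
  also have "\<dots> \<le> 1 + ?y + ?y\<^sup>2" using assms by (intro exp_bound) auto
  also have "?y\<^sup>2 \<le> ?y" using assms by (simp add: power2_eq_square field_simps)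
  finally show ?thesis by simp
qed (use assms in auto)

text \<open>The second moment method runs over pairs of a colouring and a point, where each colour
  fails with probability at most \<open>1 / (2 * t)\<close>. Independence of the colours is
  available only for a fixed colouring, so a good colouring is chosen by averaging first.\<close>

lemma card_unsat_spread_le:
  fixes H :: "lit set set"
  assumes H: "finite H" "\<And>T. T \<in> H \<Longrightarrow> finite T \<and> card T = k"
      "\<And>T. T \<in> H \<Longrightarrow> inj_on lit_var T" "\<And>T. T \<in> H \<Longrightarrow> lit_var ` T \<subseteq> {..<n}"
    and card_H: "card H = C ^ k"
    and spread: "\<And>T S. T \<in> H \<Longrightarrow> S \<subseteq> T \<Longrightarrow> card {T'\<in>H. S \<subseteq> T'} \<le> C ^ (k - card S)"
    and t: "t \<ge> 1" and C: "C \<ge> 8 * k * t\<^sup>2" "C > 0"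
  shows "card {x \<in> cube n. \<forall>T\<in>H. \<not> sat T x} * 2 ^ t \<le> 2 ^ n"
proof -
  define K where "K = {..<n} \<rightarrow>\<^sub>E {..<t}"
  \<comment> \<open>The event that colour \<open>i\<close> fails. It depends on \<open>x\<close>
    only through the variables of colour \<open>i\<close>.\<close>
  define Q where "Q i c x \<longleftrightarrow> (\<forall>T\<in>H. \<not> ((\<forall>l\<in>T. c (lit_var l) = i) \<and> sat T x))" for i and c :: "nat \<Rightarrow> nat" and x
  define p where "p i c = card {x \<in> cube n. Q i c x}" for i c
  have fin_K: "finite K" and card_K: "card K = t ^ n"
    by (simp_all add: K_def finite_PiE card_PiE)
  \<comment> \<open>The number of joint choices of colour and truth value for one variable.\<close>
  define q where "q = real (2 * t)"
  have q: "q \<ge> 1" "q > 0" using t by (simp_all add: q_def)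
  have sum_p: "(\<Sum>c\<in>K. real (p i c)) \<le> 1 / (2 * real t) * q ^ n" if i: "i < t" for i
  proof -
    define A where "A T = {c \<in> K. \<forall>l\<in>T. c (lit_var l) = i} \<times> {x \<in> cube n. sat T x}" for T
    have card_A: "card (A T) = q ^ n / q ^ card T" if "inj_on lit_var T" "lit_var ` T \<subseteq> {..<n}" for T
    proof -
      have "card T \<le> n"
        using that card_mono[OF _ that(2)] by (simp add: card_image)
      then have "q ^ n / q ^ card T = q ^ (n - card T)" using q by (simp add: power_diff)
      then show ?thesis
        using card_colourings[OF that i] card_sat[OF that]
        by (simp add: A_def K_def card_cartesian_product q_def power_mult_distrib mult.commute)
    qed
    have A_Int: "A T \<inter> A T' = A (T \<union> T')" for T T' by (auto simp: A_def)
    have A_empty: "A T = {}" if "\<not> inj_on lit_var T" for T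
      using unsat_if_inconsistent[OF that] by (auto simp: A_def)
    \<comment> \<open>Contradictory terms have disjoint events. Otherwise the union fixes
      \<open>2 * k - card (T \<inter> T')\<close> variables in both colour and value.\<close>
    have pair: "card (A T \<inter> A T') \<le> q ^ n / q ^ (2 * k) * q ^ card (T \<inter> T')"
      if T: "T \<in> H" "T' \<in> H" for T T'
    proof (cases "inj_on lit_var (T \<union> T')")
      case True
      have "card (T \<union> T') + card (T \<inter> T') = 2 * k"
        using H(2)[OF T(1)] H(2)[OF T(2)] card_Un_Int[of T T'] by simp
      then have "q ^ (2 * k) = q ^ card (T \<union> T') * q ^ card (T \<inter> T')"
        by (metis power_add)
      then show ?thesis
        using card_A[OF True] H(4)[OF T(1)] H(4)[OF T(2)] q
        by (simp add: A_Int image_Un field_simps)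
    qed (use q in \<open>simp add: A_Int A_empty\<close>)
    have a: "real (\<Sum>T\<in>H. card (A T)) = C ^ k * (q ^ n / q ^ k)"
      using H card_A by (simp add: card_H)
    have "real (\<Sum>T\<in>H. \<Sum>T'\<in>H. card (A T \<inter> A T'))
        \<le> (\<Sum>T\<in>H. \<Sum>T'\<in>H. q ^ n / q ^ (2 * k) * q ^ card (T \<inter> T'))"
      unfolding of_nat_sum by (intro sum_mono pair)
    also have "\<dots> = q ^ n / q ^ (2 * k) * (\<Sum>T\<in>H. \<Sum>T'\<in>H. q ^ card (T \<inter> T'))"
      by (simp add: sum_distrib_left)
    also have "\<dots> \<le> q ^ n / q ^ (2 * k) * (\<Sum>T\<in>H. real C ^ k * (1 + 1 / (2 * real t)))"
    proof (intro mult_left_mono sum_mono)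
      fix T assume T: "T \<in> H"
      have "(\<Sum>T'\<in>H. q ^ card (T \<inter> T')) \<le> real C ^ k * (1 + (q - 1) / C) ^ k"
        using spread_sum_le[OF H(1,2) _ C(2) spread T, of "q - 1"] q by simp
      also have "\<dots> \<le> real C ^ k * (1 + 1 / (2 * real t))"
        using power_one_plus_le[OF t C] t by (intro mult_left_mono) (simp_all add: q_def of_nat_diff)
      finally show "(\<Sum>T'\<in>H. q ^ card (T \<inter> T')) \<le> real C ^ k * (1 + 1 / (2 * real t))" .
    qed (use q in simp)
    finally have b: "real (\<Sum>T\<in>H. \<Sum>T'\<in>H. card (A T \<inter> A T'))
        \<le> q ^ n / q ^ (2 * k) * (real C ^ k * (real C ^ k * (1 + 1 / (2 * real t))))"
      by (simp add: card_H)
    have N: "real (card (K \<times> cube n)) = q ^ n"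
      by (simp add: card_cartesian_product card_K card_cube q_def power_mult_distrib)
    have "real (card {\<omega> \<in> K \<times> cube n. \<forall>T\<in>H. \<omega> \<notin> A T}) \<le> 1 / (2 * real t) * card (K \<times> cube n)"
    proof (rule second_moment)
      have "0 < real (\<Sum>T\<in>H. card (A T))" unfolding a using q C(2) by simp
      then show "0 < (\<Sum>T\<in>H. card (A T))" by (simp only: of_nat_0_less_iff)
      have regroup: "y * (y / (x * x) * (z * (z * e))) = e * (z * (y / x))\<^sup>2" for x y z e :: real
        by (simp add: power2_eq_square)
      have "real (card (K \<times> cube n) * (\<Sum>T\<in>H. \<Sum>T'\<in>H. card (A T \<inter> A T')))
          \<le> q ^ n * (q ^ n / q ^ (2 * k) * (real C ^ k * (real C ^ k * (1 + 1 / (2 * real t)))))"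
        unfolding of_nat_mult N using b q by (intro mult_left_mono) auto
      also have "\<dots> = (1 + 1 / (2 * real t)) * (real (\<Sum>T\<in>H. card (A T)))\<^sup>2"
        unfolding a of_nat_power mult_2[of k] power_add by (rule regroup)
      finally show "real (card (K \<times> cube n) * (\<Sum>T\<in>H. \<Sum>T'\<in>H. card (A T \<inter> A T')))
          \<le> (1 + 1 / (2 * real t)) * real ((\<Sum>T\<in>H. card (A T))\<^sup>2)"
        by simp
    qed (use fin_K finite_cube H in \<open>auto simp: A_def\<close>)
    moreover have "{\<omega> \<in> K \<times> cube n. \<forall>T\<in>H. \<omega> \<notin> A T} = (SIGMA c:K. {x \<in> cube n. Q i c x})"
      by (auto simp: A_def Q_def)
    ultimately show ?thesis
      using fin_K finite_cube unfolding N by (simp add: p_def)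
  qed
  \<comment> \<open>On average over the colourings, the failure probabilities of the
    \<open>t\<close> colours add up to at most 1/2. A colouring attaining this has every single one
    of them at most 1/2.\<close>
  have "\<exists>c\<in>K. (\<Sum>i<t. real (p i c)) \<le> 2 ^ n / 2"
  proof (rule ccontr)
    assume "\<not> ?thesis"
    then have "(\<Sum>c\<in>K. 2 ^ n / 2) < (\<Sum>c\<in>K. \<Sum>i<t. real (p i c))"
      using fin_K card_K t by (intro sum_strict_mono) (auto simp: not_le)
    also have "\<dots> = (\<Sum>i<t. \<Sum>c\<in>K. real (p i c))" by (rule sum.swap)
    also have "\<dots> \<le> (\<Sum>i<t. 1 / (2 * real t) * q ^ n)"
      by (intro sum_mono sum_p) auto
    also have "\<dots> = (\<Sum>c\<in>K. 2 ^ n / 2)"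
      using t by (simp add: card_K q_def power_mult_distrib)
    finally show False by simp
  qed
  then obtain c where c: "(\<Sum>i<t. real (p i c)) \<le> 2 ^ n / 2" by blast
  have "p i c * 2 \<le> 2 ^ n" if "i < t" for i
  proof -
    have "real (p i c) \<le> (\<Sum>i<t. real (p i c))"
      using that by (intro member_le_sum) auto
    with c have "real (p i c * 2) \<le> real (2 ^ n)" by simp
    then show ?thesis by (simp only: of_nat_le_iff)
  qed
  then have "card {x \<in> cube n. \<forall>i<t. Q i c x} * 2 ^ t \<le> 2 ^ n"
  proof (intro card_blocks_le[where c = c and E = "\<lambda>i. Q i c"])
    show "Q i c x = Q i c y" if *: "\<And>v. c v = i \<Longrightarrow> x v = y v" for i x y
    proof -
      have "lit_eval l x = lit_eval l y" if "c (lit_var l) = i" for l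
        using *[OF that] by (cases l) auto
      then show ?thesis unfolding Q_def by blast
    qed
  qed (simp add: p_def)
  moreover have "card {x \<in> cube n. \<forall>T\<in>H. \<not> sat T x} \<le> card {x \<in> cube n. \<forall>i<t. Q i c x}"
    by (intro card_mono) (auto simp: finite_cube Q_def)
  ultimately show ?thesis
    by (meson le_trans mult_le_mono1)
qed

section \<open>Coverable terms and the passage to a core\<close>

text \<open>
  The exponents \<open>w - card Y\<close> make both budgets multiplicative along a chain of cores: \<open>C ^ (k - z)\<close>
  coverable terms of size \<open>k\<close> over a core of size \<open>z\<close> pay exactly for \<open>C ^ (w - z)\<close> terms, and the
  factor \<open>2\<close> in the error absorbs the failure probability of the petals.
\<close>

definition coverable :: "nat \<Rightarrow> nat \<Rightarrow> nat \<Rightarrow> nat \<Rightarrow> dnf \<Rightarrow> lit set \<Rightarrow> bool" where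
  "coverable n w C t F Y \<longleftrightarrow> inj_on lit_var Y \<and> lit_var ` Y \<subseteq> {..<n} \<and> card Y \<le> w \<and>
     (\<exists>F'\<subseteq>F. card F' \<le> C ^ (w - card Y) \<and>
        card {x \<in> cube n. sat Y x \<and> \<not> dnf_eval F' x} * 2 ^ t \<le> (2 * C) ^ (w - card Y) * 2 ^ n)"

lemma coverable_finite:
  assumes "coverable n w C t F Y"
  shows "finite Y"
  using assms unfolding coverable_def by (meson finite_imageD finite_lessThan finite_subset)

text \<open>The summand 1 stands for the failure of the petals. It is absorbed because
  \<open>d > 0\<close> leaves a spare factor 2 in \<open>(2 * C) ^ d\<close> over
  \<open>C ^ d\<close>.\<close>

lemma one_plus_power_le:
  fixes C d e :: nat
  assumes "C > 0" "d > 0"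
  shows "1 + C ^ d * (2 * C) ^ e \<le> (2 * C) ^ (d + e)"
proof -
  have "1 + C ^ d * (2 * C) ^ e \<le> 2 * (C ^ d * (2 * C) ^ e)"
    using assms by (simp add: Suc_leI)
  also have "\<dots> \<le> 2 ^ d * (C ^ d * (2 * C) ^ e)"
    using assms by (intro mult_right_mono) (auto intro: self_le_power)
  finally show ?thesis by (simp add: power_add power_mult_distrib mult_ac)
qed

text \<open>The covers of the terms in a spread \<open>H\<close> are merged into one cover of their
  core \<open>Z\<close>. Its error is at most the failure probability of the petals plus the errors
  of the merged covers.\<close>

lemma coverable_core:
  assumes G: "finite G" "\<And>T. T \<in> G \<Longrightarrow> coverable n w C t F T \<and> card T = k"
    and large: "card G > C ^ k" and F: "finite F"
    and t: "t \<ge> 1" and C: "C \<ge> 8 * w * t\<^sup>2" "C > 0"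
  obtains Z T where "coverable n w C t F Z" "T \<in> G" "Z \<subset> T"
proof -
  have G': "finite T \<and> card T = k" if "T \<in> G" for T
    using G(2)[OF that] coverable_finite by blast
  obtain Z H where H: "H \<subseteq> G" "card Z < k" "finite Z" "\<And>T. T \<in> H \<Longrightarrow> Z \<subseteq> T"
    "card H = C ^ (k - card Z)"
    and spread: "\<And>S T. T \<in> H \<Longrightarrow> Z \<subseteq> S \<Longrightarrow> S \<subseteq> T \<Longrightarrow> card {T\<in>H. S \<subseteq> T} \<le> C ^ (k - card S)"
    by (rule spread_subfamily[OF G(1) _ large], erule G') (rule that)
  have "H \<noteq> {}" using H(5) C(2) by auto
  then obtain T0 where T0: "T0 \<in> H" by blast
  have finH: "finite H" using H(1) G(1) by (rule finite_subset)
  have kw: "k \<le> w" using G(2)[of T0] T0 H(1) by (auto simp: coverable_def)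
  let ?r = "\<lambda>T. T - Z"
  have inj: "inj_on ?r H"
    using H(4) by (intro inj_onI) blast
  \<comment> \<open>The petals form a spread family with \<open>k - card Z\<close> in place of
    \<open>k\<close>: their link bound at \<open>S\<close> is the bound for \<open>H\<close> at
    \<open>Z \<union> S\<close>.\<close>
  have "card {x \<in> cube n. \<forall>P\<in>?r ` H. \<not> sat P x} * 2 ^ t \<le> 2 ^ n"
  proof (rule card_unsat_spread_le[where C = C and k = "k - card Z"])
    show "finite P \<and> card P = k - card Z" if "P \<in> ?r ` H" for P
      using that H G' by (auto simp: card_Diff_subset subset_iff)
    show "inj_on lit_var P" if "P \<in> ?r ` H" for P
      using that H(1) G(2) by (auto simp: coverable_def intro: inj_on_subset)
    show "lit_var ` P \<subseteq> {..<n}" if "P \<in> ?r ` H" for P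
      using that H(1) G(2) by (fastforce simp: coverable_def)
    show "card (?r ` H) = C ^ (k - card Z)" using inj H(5) by (simp add: card_image)
    show "card {P' \<in> ?r ` H. S \<subseteq> P'} \<le> C ^ (k - card Z - card S)" if P: "P \<in> ?r ` H" and S: "S \<subseteq> P" for P S
    proof -
      obtain T where T: "T \<in> H" "P = T - Z" using P by blast
      have fin: "finite S"
        using T S H(1) G' by (meson finite_Diff finite_subset subset_iff)
      have disj: "S \<inter> Z = {}" using T S by blast
      have "{P' \<in> ?r ` H. S \<subseteq> P'} = ?r ` {T'\<in>H. Z \<union> S \<subseteq> T'}"
        using disj H(4) by blast
      then have "card {P' \<in> ?r ` H. S \<subseteq> P'} \<le> card {T'\<in>H. Z \<union> S \<subseteq> T'}"
        using finH by (simp add: card_image_le)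
      also have "\<dots> \<le> C ^ (k - card (Z \<union> S))"
        using T S H(4)[OF T(1)] by (intro spread[OF T(1)]) auto
      also have "card (Z \<union> S) = card Z + card S"
        using disj fin H(3) by (intro card_Un_disjoint) auto
      finally show ?thesis by simp
    qed
    show "C \<ge> 8 * (k - card Z) * t\<^sup>2"
      using kw by (intro order_trans[OF _ C(1)] mult_le_mono) auto
  qed (use finH t C in auto)
  note no_petal = this
  have "\<forall>T\<in>H. \<exists>F'\<subseteq>F. card F' \<le> C ^ (w - k) \<and>
      card {x \<in> cube n. sat T x \<and> \<not> dnf_eval F' x} * 2 ^ t \<le> (2 * C) ^ (w - k) * 2 ^ n"
    using G(2) H(1) unfolding coverable_def by blast
  from bchoice[OF this] obtain f where f': "\<forall>T\<in>H. f T \<subseteq> F \<and> card (f T) \<le> C ^ (w - k) \<and>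
      card {x \<in> cube n. sat T x \<and> \<not> dnf_eval (f T) x} * 2 ^ t \<le> (2 * C) ^ (w - k) * 2 ^ n" ..
  have f: "f T \<subseteq> F" "card (f T) \<le> C ^ (w - k)"
      "card {x \<in> cube n. sat T x \<and> \<not> dnf_eval (f T) x} * 2 ^ t \<le> (2 * C) ^ (w - k) * 2 ^ n" if "T \<in> H" for T
    using bspec[OF f' that] by simp_all
  define F' where "F' = (\<Union>T\<in>H. f T)"
  have d: "w - card Z = (k - card Z) + (w - k)" using kw H(2) by simp
  have "card F' \<le> (\<Sum>T\<in>H. card (f T))"
    unfolding F'_def using finH by (rule card_UN_le)
  also have "\<dots> \<le> card H * C ^ (w - k)"
    using sum_bounded_above[of H "\<lambda>T. card (f T)", OF f(2)] by simp
  also have "\<dots> = C ^ (w - card Z)" unfolding H(5) d by (rule power_add[symmetric])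
  finally have card_F': "card F' \<le> C ^ (w - card Z)" .
  let ?B = "\<lambda>T. {x \<in> cube n. sat T x \<and> \<not> dnf_eval (f T) x}"
  \<comment> \<open>A point satisfying \<open>Z\<close> either misses every petal or satisfies a
    whole term \<open>T \<in> H\<close>; in the latter case it escapes the cover of
    \<open>T\<close>.\<close>
  have "{x \<in> cube n. sat Z x \<and> \<not> dnf_eval F' x}
      \<subseteq> {x \<in> cube n. \<forall>P\<in>?r ` H. \<not> sat P x} \<union> (\<Union>T\<in>H. ?B T)"
  proof
    fix x assume "x \<in> {x \<in> cube n. sat Z x \<and> \<not> dnf_eval F' x}"
    then have x: "x \<in> cube n" "sat Z x" "\<And>T. T \<in> H \<Longrightarrow> \<not> dnf_eval (f T) x"
      by (auto simp: F'_def dnf_eval_def)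
    have "sat T x" if "sat (T - Z) x" for T using that x(2) by blast
    then show "x \<in> {x \<in> cube n. \<forall>P\<in>?r ` H. \<not> sat P x} \<union> (\<Union>T\<in>H. ?B T)"
      using x(1,3) by blast
  qed
  then have "card {x \<in> cube n. sat Z x \<and> \<not> dnf_eval F' x}
      \<le> card ({x \<in> cube n. \<forall>P\<in>?r ` H. \<not> sat P x} \<union> (\<Union>T\<in>H. ?B T))"
    using finH finite_cube by (intro card_mono) auto
  also have "\<dots> \<le> card {x \<in> cube n. \<forall>P\<in>?r ` H. \<not> sat P x} + (\<Sum>T\<in>H. card (?B T))"
    by (rule order_trans[OF card_Un_le add_left_mono[OF card_UN_le[OF finH]]])
  finally have "card {x \<in> cube n. sat Z x \<and> \<not> dnf_eval F' x} * 2 ^ t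
      \<le> (card {x \<in> cube n. \<forall>P\<in>?r ` H. \<not> sat P x} + (\<Sum>T\<in>H. card (?B T))) * 2 ^ t"
    by (rule mult_le_mono1)
  also have "\<dots> = card {x \<in> cube n. \<forall>P\<in>?r ` H. \<not> sat P x} * 2 ^ t + (\<Sum>T\<in>H. card (?B T) * 2 ^ t)"
    by (simp only: add_mult_distrib sum_distrib_right)
  also have "\<dots> \<le> 2 ^ n + card H * ((2 * C) ^ (w - k) * 2 ^ n)"
    using sum_bounded_above[of H "\<lambda>T. card (?B T) * 2 ^ t", OF f(3)] no_petal by simp
  also have "\<dots> = (1 + C ^ (k - card Z) * (2 * C) ^ (w - k)) * 2 ^ n"
    by (simp add: H(5) algebra_simps)
  also have "\<dots> \<le> (2 * C) ^ (w - card Z) * 2 ^ n"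
    unfolding d using C(2) H(2) by (intro mult_le_mono1 one_plus_power_le) auto
  finally have err: "card {x \<in> cube n. sat Z x \<and> \<not> dnf_eval F' x} * 2 ^ t \<le> (2 * C) ^ (w - card Z) * 2 ^ n" .
  have T0': "T0 \<in> G" "Z \<subseteq> T0" using T0 H(1,4) by auto
  have "coverable n w C t F Z"
    unfolding coverable_def
  proof (intro conjI exI)
    show "inj_on lit_var Z" "lit_var ` Z \<subseteq> {..<n}"
      using T0' G(2)[OF T0'(1)] by (auto simp: coverable_def intro: inj_on_subset)
    show "F' \<subseteq> F" using f(1) by (auto simp: F'_def)
  qed (use card_F' err kw H(2) in auto)
  moreover have "Z \<subset> T0" using T0' G'[OF T0'(1)] H(2) by auto
  ultimately show thesis using that T0'(1) by blast
qed

section \<open>The two approximators from the minimal coverable terms\<close>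

lemma sandwich_exists:
  assumes F: "width_dnf n w F" and t: "t \<ge> 1" and C: "C \<ge> 8 * w * t\<^sup>2" "C > 0"
  obtains Fl Fu where "width_dnf n w Fl" "card Fl \<le> (w + 1) * C ^ w"
    "width_dnf n w Fu" "card Fu \<le> (w + 1) * C ^ w"
    "\<And>x. dnf_eval Fl x \<Longrightarrow> dnf_eval F x" "\<And>x. dnf_eval F x \<Longrightarrow> dnf_eval Fu x"
    "card {x \<in> cube n. dnf_eval Fu x \<and> \<not> dnf_eval Fl x} * 2 ^ t \<le> (w + 1) * (2 * C) ^ w * 2 ^ n"
proof -
  \<comment> \<open>A term with a contradictory pair is satisfied by no point, so leaving it out
    does not change the function.\<close>
  define F0 where "F0 = {T \<in> F. inj_on lit_var T}"
  have F0: "finite F0" "F0 \<subseteq> F" using F by (auto simp: F0_def width_dnf_def is_dnf_def)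
  let ?cov = "coverable n w C t F0"
  define M where "M = {Y. ?cov Y \<and> (\<forall>Z. ?cov Z \<longrightarrow> \<not> Z \<subset> Y)}"
  have "M \<subseteq> Pow (Pos ` {..<n} \<union> Neg ` {..<n})"
  proof
    fix Y assume "Y \<in> M"
    then have "lit_var ` Y \<subseteq> {..<n}" by (simp add: M_def coverable_def)
    then have "l \<in> Pos ` {..<n} \<union> Neg ` {..<n}" if "l \<in> Y" for l
      using that by (cases l) force+
    then show "Y \<in> Pow (Pos ` {..<n} \<union> Neg ` {..<n})" by blast
  qed
  then have finM: "finite M" by (rule finite_subset) simp
  have level: "card {Y \<in> M. card Y = k} \<le> C ^ k" for k
  proof (rule ccontr)
    assume "\<not> ?thesis"
    then have large: "C ^ k < card {Y \<in> M. card Y = k}" by simp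
    obtain Z T where "?cov Z" "T \<in> {Y \<in> M. card Y = k}" "Z \<subset> T"
    proof (rule coverable_core[OF _ _ large F0(1) t C])
      show "finite {Y \<in> M. card Y = k}" using finM by simp
      show "?cov T \<and> card T = k" if "T \<in> {Y \<in> M. card Y = k}" for T
        using that by (simp add: M_def)
    qed (rule that)
    then show False by (simp add: M_def)
  qed
  \<comment> \<open>Grouping by size gives \<open>w + 1\<close> levels of at most
    \<open>C ^ k\<close> terms each. This yields both size bounds and the error bound.\<close>
  have sum_M: "(\<Sum>Y\<in>M. g (card Y)) \<le> (w + 1) * b"
    if "\<And>k. k \<le> w \<Longrightarrow> C ^ k * g k \<le> b" for g and b :: nat
  proof -
    have "(\<Sum>Y\<in>M. g (card Y)) = (\<Sum>k\<le>w. \<Sum>Y | Y \<in> M \<and> card Y = k. g (card Y))"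
      using finM by (intro sum.group[symmetric]) (auto simp: M_def coverable_def)
    also have "\<dots> = (\<Sum>k\<le>w. card {Y \<in> M. card Y = k} * g k)" by simp
    also have "\<dots> \<le> (\<Sum>k\<le>w. b)"
      using level that by (intro sum_mono order_trans[OF mult_le_mono1 that]) auto
    finally show ?thesis by simp
  qed
  have "\<forall>Y\<in>M. \<exists>F'\<subseteq>F0. card F' \<le> C ^ (w - card Y) \<and>
      card {x \<in> cube n. sat Y x \<and> \<not> dnf_eval F' x} * 2 ^ t \<le> (2 * C) ^ (w - card Y) * 2 ^ n"
    unfolding M_def coverable_def by blast
  from bchoice[OF this] obtain f where f': "\<forall>Y\<in>M. f Y \<subseteq> F0 \<and> card (f Y) \<le> C ^ (w - card Y) \<and>
      card {x \<in> cube n. sat Y x \<and> \<not> dnf_eval (f Y) x} * 2 ^ t \<le> (2 * C) ^ (w - card Y) * 2 ^ n" ..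
  have f: "f Y \<subseteq> F0" "card (f Y) \<le> C ^ (w - card Y)"
      "card {x \<in> cube n. sat Y x \<and> \<not> dnf_eval (f Y) x} * 2 ^ t \<le> (2 * C) ^ (w - card Y) * 2 ^ n" if "Y \<in> M" for Y
    using bspec[OF f' that] by simp_all
  define Fl where "Fl = (\<Union>Y\<in>M. f Y)"
  have Fl: "Fl \<subseteq> F" using f(1) F0(2) by (auto simp: Fl_def)
  show thesis
  proof (rule that[of Fl M])
    show "width_dnf n w Fl" using F Fl by (auto simp: width_dnf_def is_dnf_def intro: finite_subset)
    show "width_dnf n w M"
      unfolding width_dnf_def is_dnf_def
    proof (intro conjI ballI finM)
      fix Y assume "Y \<in> M"
      then have Y: "?cov Y" by (simp add: M_def)
      show "finite Y" using Y by (rule coverable_finite)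
      show "card Y \<le> w" using Y by (simp add: coverable_def)
      show "lit_var l < n" if "l \<in> Y" for l using Y that by (auto simp: coverable_def)
    qed
    have "card Fl \<le> (\<Sum>Y\<in>M. card (f Y))" unfolding Fl_def using finM by (rule card_UN_le)
    also have "\<dots> \<le> (\<Sum>Y\<in>M. C ^ (w - card Y))" using f(2) by (rule sum_mono)
    also have "\<dots> \<le> (w + 1) * C ^ w" by (rule sum_M) (simp flip: power_add)
    finally show "card Fl \<le> (w + 1) * C ^ w" .
    have "card M = (\<Sum>Y\<in>M. 1)" by simp
    also have "\<dots> \<le> (w + 1) * C ^ w"
      using C(2) by (intro sum_M) (simp add: power_increasing)
    finally show "card M \<le> (w + 1) * C ^ w" .
    show "dnf_eval F x" if "dnf_eval Fl x" for x using that Fl by (auto simp: dnf_eval_def)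
    show "dnf_eval M x" if "dnf_eval F x" for x
    proof -
      obtain T where T: "T \<in> F" "sat T x" using \<open>dnf_eval F x\<close> by (auto simp: dnf_eval_def)
      have inj: "inj_on lit_var T" using unsat_if_inconsistent T(2) by blast
      have "{x \<in> cube n. sat T x \<and> \<not> dnf_eval {T} x} = {}"
        by (auto simp: dnf_eval_def)
      then have c0: "card {x \<in> cube n. sat T x \<and> \<not> dnf_eval {T} x} = 0"
        by (simp only: card.empty)
      \<comment> \<open>A consistent term of \<open>F\<close> is covered by itself alone, without
        error.\<close>
      have "?cov T"
        unfolding coverable_def
      proof (intro conjI exI)
        show "lit_var ` T \<subseteq> {..<n}" "card T \<le> w"
          using F T(1) by (auto simp: width_dnf_def is_dnf_def)
        show "{T} \<subseteq> F0" using T(1) inj by (simp add: F0_def)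
        show "card {T} \<le> C ^ (w - card T)" using C(2) by simp
      qed (simp_all only: inj c0 mult_zero_left zero_le)
      \<comment> \<open>A coverable subset of \<open>T\<close> of least cardinality is
        inclusion-minimal among all coverable terms, since any coverable proper subset of it would
        lie in \<open>T\<close> too.\<close>
      then have "\<exists>Y. (?cov Y \<and> Y \<subseteq> T) \<and> (\<forall>Z. ?cov Z \<and> Z \<subseteq> T \<longrightarrow> card Y \<le> card Z)"
        by (intro ex_has_least_nat[where k = T]) simp
      then obtain Y where Y: "?cov Y" "Y \<subseteq> T" "\<And>Z. ?cov Z \<Longrightarrow> Z \<subseteq> T \<Longrightarrow> card Y \<le> card Z"
        by blast
      have "\<not> Z \<subset> Y" if "?cov Z" for Z
        using Y(3)[OF that] Y(2) psubset_card_mono[OF coverable_finite[OF Y(1)], of Z] by force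
      with Y(1) have "Y \<in> M" by (simp add: M_def)
      then show ?thesis using T(2) Y(2) by (auto simp: dnf_eval_def)
    qed
    let ?B = "\<lambda>Y. {x \<in> cube n. sat Y x \<and> \<not> dnf_eval (f Y) x}"
    \<comment> \<open>A point in the gap satisfies some \<open>Y \<in> M\<close> but not the cover
      of \<open>Y\<close>, as that cover is part of \<open>Fl\<close>.\<close>
    have "card {x \<in> cube n. dnf_eval M x \<and> \<not> dnf_eval Fl x} \<le> card (\<Union>Y\<in>M. ?B Y)"
      using finM finite_cube by (intro card_mono) (auto simp: Fl_def dnf_eval_def)
    also have "\<dots> \<le> (\<Sum>Y\<in>M. card (?B Y))" using finM by (rule card_UN_le)
    finally have "card {x \<in> cube n. dnf_eval M x \<and> \<not> dnf_eval Fl x} * 2 ^ t \<le> (\<Sum>Y\<in>M. card (?B Y)) * 2 ^ t"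
      by (rule mult_le_mono1)
    also have "\<dots> \<le> (\<Sum>Y\<in>M. (2 * C) ^ (w - card Y) * 2 ^ n)"
      unfolding sum_distrib_right using f(3) by (rule sum_mono)
    also have "\<dots> \<le> (w + 1) * ((2 * C) ^ w * 2 ^ n)"
    proof (rule sum_M)
      fix k assume "k \<le> w"
      have "C ^ k * (2 * C) ^ (w - k) \<le> (2 * C) ^ k * (2 * C) ^ (w - k)"
        by (intro mult_le_mono1 power_mono) auto
      also have "\<dots> = (2 * C) ^ w"
        using \<open>k \<le> w\<close> by (simp only: power_add[symmetric] le_add_diff_inverse)
      finally show "C ^ k * ((2 * C) ^ (w - k) * 2 ^ n) \<le> (2 * C) ^ w * 2 ^ n"
        unfolding mult.assoc[symmetric] by (rule mult_le_mono1)
    qed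
    finally show "card {x \<in> cube n. dnf_eval M x \<and> \<not> dnf_eval Fl x} * 2 ^ t \<le> (w + 1) * (2 * C) ^ w * 2 ^ n"
      by (simp only: mult.assoc)
  qed
qed

section \<open>Choice of the parameters and conclusion\<close>

text \<open>A larger \<open>t\<close> forces a larger \<open>C\<close>, which enlarges the error
  again. A quadratic \<open>t\<close> suffices: \<open>C\<close> is at most
  \<open>2 ^ 11 * m ^ 5\<close>, so by \<open>m \<le> 2 ^ m\<close> the left side of the second
  bound has binary logarithm at most \<open>5 * m^2 + 14 * m\<close>, which is below
  \<open>t\<close> for \<open>m \<ge> 2\<close>. The factor \<open>2 ^ m\<close> there leaves an
  error of at most \<open>1 / 2 ^ m\<close>.\<close>

lemma parameter_bounds:
  fixes m w :: nat
  assumes "w \<le> m" "m \<ge> 2"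
  defines "t \<equiv> 16 * m\<^sup>2"
  defines "C \<equiv> 8 * w * t\<^sup>2"
  shows "C \<le> m ^ 16" "(w + 1) * (2 * C) ^ w * 2 ^ m \<le> 2 ^ t"
proof -
  have C_le: "C \<le> 2 ^ 11 * m ^ 5"
  proof -
    have "C = 2 ^ 11 * (w * m ^ 4)"
      by (simp add: C_def t_def power_mult_distrib flip: power_mult)
    also have "\<dots> \<le> 2 ^ 11 * (m * m ^ 4)"
      using assms(1) by (intro mult_le_mono) auto
    finally show ?thesis by (simp add: power_Suc[symmetric] del: power_Suc)
  qed
  also have "2 ^ 11 * m ^ 5 \<le> m ^ 11 * m ^ 5"
    using assms(2) by (intro mult_le_mono1 power_mono) auto
  also have "\<dots> = m ^ 16" by (simp flip: power_add)
  finally show "C \<le> m ^ 16" .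
  have m2: "m \<le> 2 ^ m" by (rule less_imp_le[OF less_exp])
  have "w + 1 \<le> 2 ^ w" by (simp add: Suc_leI less_exp)
  then have "(w + 1) * (2 * C) ^ w * 2 ^ m \<le> 2 ^ w * (2 * C) ^ w * 2 ^ m"
    by (intro mult_le_mono1)
  also have "\<dots> = (2 * (2 * C)) ^ w * 2 ^ m"
    by (simp only: power_mult_distrib)
  also have "\<dots> \<le> (2 * (2 * (2 ^ 11 * (2 ^ m) ^ 5))) ^ w * 2 ^ m"
    using m2 by (intro mult_le_mono1 power_mono mult_le_mono2 order_trans[OF C_le]) auto
  also have "\<dots> \<le> (2 * (2 * (2 ^ 11 * (2 ^ m) ^ 5))) ^ m * 2 ^ m"
    using assms(1) by (intro mult_le_mono1 power_increasing) auto
  also have "2 * (2 * (2 ^ 11 * (2 ^ m) ^ 5)) = (2::nat) ^ (13 + m * 5)"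
    by (simp add: power_add flip: power_mult)
  also have "((2::nat) ^ (13 + m * 5)) ^ m * 2 ^ m = 2 ^ ((13 + m * 5) * m + m)"
    by (simp only: power_mult power_add)
  also have "\<dots> \<le> 2 ^ t"
  proof (rule power_increasing)
    have "2 * m \<le> m * m" using assms(2) by (rule mult_le_mono1)
    moreover have "(13 + m * 5) * m + m = 5 * (m * m) + 14 * m" by (simp add: algebra_simps)
    ultimately show "(13 + m * 5) * m + m \<le> t" unfolding t_def power2_eq_square by linarith
  qed simp
  finally show "(w + 1) * (2 * C) ^ w * 2 ^ m \<le> 2 ^ t" .
qed

lemma prob_cube: "measure_pmf.prob (pmf_of_set (cube n)) A = card {x \<in> cube n. x \<in> A} / 2 ^ n"
proof -
  have "cube n \<noteq> {}" using card_cube[of n] by force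
  then show ?thesis
    by (simp add: measure_pmf_of_set finite_cube card_cube Int_def)
qed

text \<open>Both error sets lie in the gap between the upper and the lower formula.\<close>

lemma sandwichingI:
  fixes \<epsilon> :: real
  assumes "\<And>x. dnf_eval Fl x \<Longrightarrow> dnf_eval F x" "\<And>x. dnf_eval F x \<Longrightarrow> dnf_eval Fu x"
    and err: "card {x \<in> cube n. dnf_eval Fu x \<and> \<not> dnf_eval Fl x} \<le> \<epsilon> * 2 ^ n"
  shows "sandwiching n \<epsilon> (dnf_eval Fl) (dnf_eval Fu) (dnf_eval F)"
proof -
  have "measure_pmf.prob (pmf_of_set (cube n)) A \<le> \<epsilon>"
    if "\<And>x. x \<in> A \<Longrightarrow> dnf_eval Fu x \<and> \<not> dnf_eval Fl x" for A
  proof -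
    have "card {x \<in> cube n. x \<in> A} \<le> card {x \<in> cube n. dnf_eval Fu x \<and> \<not> dnf_eval Fl x}"
      using that by (intro card_mono) (auto simp: finite_cube)
    then have "real (card {x \<in> cube n. x \<in> A}) \<le> \<epsilon> * 2 ^ n" using err by linarith
    then show ?thesis by (simp add: prob_cube divide_le_eq)
  qed
  note small = this
  have "measure_pmf.prob (pmf_of_set (cube n)) {x. dnf_eval Fl x \<noteq> dnf_eval F x} \<le> \<epsilon>"
    "measure_pmf.prob (pmf_of_set (cube n)) {x. dnf_eval Fu x \<noteq> dnf_eval F x} \<le> \<epsilon>"
    using assms(1,2) by (intro small; blast)+
  then show ?thesis
    using assms(1,2) unfolding sandwiching_def le_bool_def by blast
qed

theorem theorem1p1:
  "\<exists>C::nat. \<forall>(n::nat) (w::nat) (F::dnf) (\<epsilon>::real).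
     width_dnf n w F \<and> \<epsilon> > 0 \<longrightarrow>
     (\<exists>Fl Fu.
        width_dnf n w Fl \<and> real (card Fl) \<le> size_base w \<epsilon> ^ (C * w) \<and>
        width_dnf n w Fu \<and> real (card Fu) \<le> size_base w \<epsilon> ^ (C * w) \<and>
        sandwiching n \<epsilon> (dnf_eval Fl) (dnf_eval Fu) (dnf_eval F))"
proof (intro exI[of _ 33] allI impI, elim conjE)
  fix n w F and \<epsilon> :: real
  assume F: "width_dnf n w F" and \<epsilon>: "\<epsilon> > 0"
  show "\<exists>Fl Fu. width_dnf n w Fl \<and> real (card Fl) \<le> size_base w \<epsilon> ^ (33 * w) \<and>
        width_dnf n w Fu \<and> real (card Fu) \<le> size_base w \<epsilon> ^ (33 * w) \<and>
        sandwiching n \<epsilon> (dnf_eval Fl) (dnf_eval Fu) (dnf_eval F)"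
  proof (cases "w = 0")
    case True
    \<comment> \<open>For \<open>w = 0\<close> the parameter \<open>C\<close> chosen below would
      vanish, but \<open>F\<close> is constant with at most one term and approximates itself; the
      size bound is then 1.\<close>
    have "F \<subseteq> {{}}" using F True by (auto simp: width_dnf_def is_dnf_def)
    then have "card F \<le> 1" using card_mono[of "{{}}" F] by simp
    moreover have "sandwiching n \<epsilon> (dnf_eval F) (dnf_eval F) (dnf_eval F)"
      using \<epsilon> by (intro sandwichingI) auto
    ultimately show ?thesis using F True by auto
  next
    case False
    define b where "b = size_base w \<epsilon>"
    define \<delta> where "\<delta> = min \<epsilon> (1 / 2)"
    \<comment> \<open>The base rounded up to an integer; it is at least \<open>w\<close>, and
      \<open>2 ^ m\<close> is at least \<open>1 / \<delta>\<close>.\<close>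
    define m where "m = nat \<lceil>b\<rceil>"
    define t where "t = 16 * m\<^sup>2"
    define C where "C = 8 * w * t\<^sup>2"
    have \<delta>: "\<delta> > 0" "\<delta> \<le> 1 / 2" "\<delta> \<le> \<epsilon>" using \<epsilon> by (auto simp: \<delta>_def)
    have L: "log 2 (1 / \<delta>) \<ge> 1"
      using \<delta> by (simp add: le_log_iff field_simps)
    have b: "b \<ge> 2" "real w * log 2 (1 / \<delta>) \<le> b" by (simp_all add: b_def size_base_def \<delta>_def)
    have "real w * 1 \<le> real w * log 2 (1 / \<delta>)" using L by (intro mult_left_mono) auto
    then have wb: "real w \<le> b" using b(2) by simp
    have "1 * log 2 (1 / \<delta>) \<le> real w * log 2 (1 / \<delta>)" using L False by (intro mult_right_mono) auto
    then have Lb: "log 2 (1 / \<delta>) \<le> b" using b(2) by simp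
    have m: "b \<le> m" "m \<le> b + 1" using b(1) by (auto simp: m_def)
    have wm: "w \<le> m" "m \<ge> 2" using wb b m by linarith+
    have "log 2 (1 / \<delta>) \<le> m" using Lb m by simp
    then have m\<delta>: "1 / \<delta> \<le> 2 ^ m" using \<delta> by (simp add: log_le_iff powr_realpow)
    have "real C \<le> real m ^ 16"
      using parameter_bounds(1)[OF wm] unfolding C_def t_def by (metis of_nat_le_iff of_nat_power)
    also have "\<dots> \<le> (b\<^sup>2) ^ 16"
    proof (intro power_mono)
      have "b + 1 \<le> b * 2" using b(1) by simp
      also have "\<dots> \<le> b * b" using b(1) by (intro mult_left_mono) auto
      finally show "real m \<le> b\<^sup>2" using m(2) by (simp add: power2_eq_square)
    qed simp
    also have "\<dots> = b ^ 32" by (simp flip: power_mult)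
    finally have Cb: "real C \<le> b ^ 32" .
    \<comment> \<open>The exponent 33 arises from \<open>C \<le> m ^ 16\<close> and
      \<open>m \<le> b\<^sup>2\<close>, giving \<open>b ^ 32\<close>, and one more factor
      \<open>b\<close> per unit of \<open>w\<close> to absorb
      \<open>w + 1 \<le> 2 ^ w\<close>.\<close>
    have size: "real k \<le> b ^ (33 * w)" if "k \<le> (w + 1) * C ^ w" for k
    proof -
      have "w + 1 \<le> 2 ^ w" by (simp add: Suc_leI less_exp)
      then have "(w + 1) * C ^ w \<le> 2 ^ w * C ^ w" by (rule mult_le_mono1)
      with that have "k \<le> 2 ^ w * C ^ w" by (rule order_trans)
      then have "real k \<le> real (2 ^ w * C ^ w)" by (simp only: of_nat_le_iff)
      also have "\<dots> = 2 ^ w * real C ^ w" by simp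
      also have "\<dots> \<le> b ^ w * (b ^ 32) ^ w"
        using b(1) Cb by (intro mult_mono power_mono) auto
      also have "\<dots> = b ^ (33 * w)" by (simp flip: power_mult power_add)
      finally show ?thesis .
    qed
    have tC: "t \<ge> 1" "C > 0" using wm False by (auto simp: t_def C_def)
    obtain Fl Fu where G: "width_dnf n w Fl" "card Fl \<le> (w + 1) * C ^ w"
      "width_dnf n w Fu" "card Fu \<le> (w + 1) * C ^ w"
      "\<And>x. dnf_eval Fl x \<Longrightarrow> dnf_eval F x" "\<And>x. dnf_eval F x \<Longrightarrow> dnf_eval Fu x"
      and err: "card {x \<in> cube n. dnf_eval Fu x \<and> \<not> dnf_eval Fl x} * 2 ^ t \<le> (w + 1) * (2 * C) ^ w * 2 ^ n"
      by (rule sandwich_exists[OF F tC(1) eq_refl[OF C_def[symmetric]] tC(2)]) (rule that)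
    let ?e = "card {x \<in> cube n. dnf_eval Fu x \<and> \<not> dnf_eval Fl x}"
    \<comment> \<open>After multiplying by \<open>2 ^ m\<close>, the factor \<open>2 ^ t\<close>
      cancels, so the gap has probability at most \<open>1 / 2 ^ m\<close>.\<close>
    have "?e * 2 ^ t * 2 ^ m \<le> (w + 1) * (2 * C) ^ w * 2 ^ n * 2 ^ m"
      using err by (rule mult_le_mono1)
    also have "\<dots> = ((w + 1) * (2 * C) ^ w * 2 ^ m) * 2 ^ n" by (simp only: mult_ac)
    also have "\<dots> \<le> 2 ^ t * 2 ^ n"
      using parameter_bounds(2)[OF wm] unfolding C_def t_def by (rule mult_le_mono1)
    finally have "?e * 2 ^ m \<le> 2 ^ n" by (simp add: ac_simps)
    then have "real (?e * 2 ^ m) \<le> real (2 ^ n)" by (simp only: of_nat_le_iff)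
    then have "real ?e * 2 ^ m \<le> 2 ^ n" by simp
    then have "real ?e \<le> 2 ^ n / 2 ^ m" by (simp add: le_divide_eq)
    also have "\<dots> \<le> \<epsilon> * 2 ^ n"
    proof -
      have "1 / 2 ^ m \<le> \<delta>" using m\<delta> \<delta>(1) by (simp add: field_simps)
      then have "1 / 2 ^ m * 2 ^ n \<le> \<epsilon> * 2 ^ n" using \<delta>(3) by (intro mult_right_mono) auto
      then show ?thesis by simp
    qed
    finally have "sandwiching n \<epsilon> (dnf_eval Fl) (dnf_eval Fu) (dnf_eval F)"
      using G by (intro sandwichingI) auto
    then show ?thesis using G size unfolding b_def by blast
  qed
qed

end
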